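(* Consider a linear dynamical system with dynamics given by $F$ and $G$ (that is, $s = Fu + Gw$ as in the context), and let $\gamma>0$. A causal controller $\mathcal{K}$ is a solution to the regret-suboptimal problem in this system at performance level $\gamma$ if and only if $\mathcal{K}$ is a solution to the suboptimal $H_\infty$ problem with performance level $1$ in a linear dynamical system with dynamics given by $F$ and $G'$, where $G' = G\Delta^{-1}$ and $\Delta$ is the unique causal operator such that $$\gamma^2 I + G^{\top}(I + FF^{\top})^{-1}G = \Delta^{\top}\Delta .$$
   Context: Linear system over a finite horizon $t = 0,\dots,T-1$: $x_{t+1} = A_t x_t + B_{u,t}u_t + B_{w,t}w_t$, $x_0 = 0$, with state $x_t\in\mathbb{R}^n$, control $u_t\in\mathbb{R}^m$, disturbance $w_t\in\mathbb{R}^p$, known real matrices $A_t, B_{u,t}, B_{w,t}$, and state costs $Q_t \succeq 0$. Control costs are normalized to $R_t = I$. Let $s_t = Q_t^{1/2}x_t$ and $s=(s_0,\dots,s_{T-1})$, $u=(u_0,\dots,u_{T-1})$, $w=(w_0,\dots,w_{T-1})$. Then $s = Fu + Gw$, where $F, G$ are strictly causal linear operators ($T\times T$ block matrices) capturing the dynamics. An operator is causal if it is (block) lower-triangular with respect to time. The cost is $\mathrm{cost}(w,u) = \sum_{t=0}^{T-1}(x_t^\top Q_t x_t + u_t^\top u_t) = \|s\|_2^2 + \|u\|_2^2$, and $\|w\|_2^2=\sum_{t=0}^{T-1}\|w_t\|^2$. A control policy is causal if the action it selects at time $t$ depends only on $w_0,\dots,w_t$. Controllers are thought of as linear operators mapping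 disturbances to control actions; a causal controller is one whose operator is causal. Regret-suboptimal problem at performance level $\gamma>0$: find a causal control policy such that $\dfrac{\mathrm{cost}(w,u) - \min_{u'}\mathrm{cost}(w,u')}{\|w\|_2^2} < \gamma^2$ for all disturbances $w$ (the minimum is over all control sequences $u'$), or determine that none exists. Suboptimal $H_\infty$ problem at performance level $\gamma>0$: find a causal control policy such that $\sup_{w}\dfrac{\mathrm{cost}(w,u)}{\|w\|_2^2} < \gamma^2$, or determine that none exists. The system with dynamics given by $F$ and $G'$ is $s = Fu + G'z$ with the same cost $\|s\|_2^2+\|u\|_2^2$; it arises from the original one by the change of variables $z = \Delta w$, and $z$ plays the role of the disturbance in it.
   Formalization: Δ is not literally unique (−Δ also works): it is proved to exist, unique up to a block-diagonal orthogonal left factor, and the equivalence holds for every such Δ; in the system (F, G′) the controller acts on z = Δw, so it is written KΔ⁻¹ (for the same matrix K the claim fails). *)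

theory Defs
  imports "HOL-Analysis.Analysis"
begin

text \<open>
  The horizon is a finite linearly ordered type \<open>'t\<close>, so that \<open>T = CARD('t)\<close>.  A signal
  with values in \<open>real^'m\<close> is a stacked vector in \<open>real^('t \<times> 'm)\<close>; its Euclidean norm is the
  norm of the whole sequence.  Accordingly a \<open>T \<times> T\<close> block matrix is a matrix whose row and
  column indices are pairs (time, component).
\<close>

definition block :: "real^('t::finite \<times> 'm::finite) \<Rightarrow> 't \<Rightarrow> real^'m" where
  "block u t = (\<chi> i. u $ (t, i))"

definition causal ::
    "real^('t::{finite,linorder} \<times> 'p::finite)^('t \<times> 'm::finite) \<Rightarrow> bool" where
  "causal K \<longleftrightarrow> (\<forall>t s i j. t < s \<longrightarrow> K $ (t, i) $ (s, j) = 0)"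

definition strictly_causal ::
    "real^('t::{finite,linorder} \<times> 'p::finite)^('t \<times> 'm::finite) \<Rightarrow> bool" where
  "strictly_causal K \<longleftrightarrow> (\<forall>t s i j. t \<le> s \<longrightarrow> K $ (t, i) $ (s, j) = 0)"

definition block_diagonal ::
    "real^('t::finite \<times> 'p::finite)^('t \<times> 'm::finite) \<Rightarrow> bool" where
  "block_diagonal K \<longleftrightarrow> (\<forall>t s i j. t \<noteq> s \<longrightarrow> K $ (t, i) $ (s, j) = 0)"

definition psd :: "real^'n^'n \<Rightarrow> bool" where
  "psd Q \<longleftrightarrow> transpose Q = Q \<and> (\<forall>x. 0 \<le> x \<bullet> (Q *v x))"

text \<open>
  The recursion \<open>x\<^sub>0 = 0\<close>, \<open>x\<^sub>t\<^sub>+\<^sub>1 = A\<^sub>t x\<^sub>t + B\<^sub>u\<^sub>,\<^sub>t u\<^sub>t + B\<^sub>w\<^sub>,\<^sub>t w\<^sub>t\<close>, where \<open>Max {..<t}\<close> is the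
  time just before \<open>t\<close>.
\<close>

function state ::
    "('t::{finite,linorder} \<Rightarrow> real^'n^'n) \<Rightarrow> ('t \<Rightarrow> real^'m^'n) \<Rightarrow> ('t \<Rightarrow> real^'p^'n)
     \<Rightarrow> real^('t \<times> 'm::finite) \<Rightarrow> real^('t \<times> 'p::finite) \<Rightarrow> 't \<Rightarrow> real^'n" where
  "state A Bu Bw u w t =
     (if {..<t} = {} then 0
      else let r = Max {..<t}
           in A r *v state A Bu Bw u w r + Bu r *v block u r + Bw r *v block w r)"
  by pat_completeness auto
termination
proof (relation "Wellfounded.measure (\<lambda>(A, Bu, Bw, u, w, t). card {..<t})", goal_cases)
  case (2 A Bu Bw u w t r)
  then have "r < t"
    using Max_in[of "{..<t}"] by simp
  then have "{..<r} \<subset> {..<t}"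
    by auto
  then show ?case
    by (simp add: psubset_card_mono)
qed simp

declare state.simps [simp del]

text \<open>The output \<open>s\<^sub>t = S\<^sub>t x\<^sub>t\<close>; below \<open>S\<^sub>t\<close> is the positive semidefinite square root of \<open>Q\<^sub>t\<close>.\<close>

definition perf_output ::
    "('t::{finite,linorder} \<Rightarrow> real^'n^'n) \<Rightarrow> ('t \<Rightarrow> real^'m^'n) \<Rightarrow> ('t \<Rightarrow> real^'p^'n)
     \<Rightarrow> ('t \<Rightarrow> real^'n^'n)
     \<Rightarrow> real^('t \<times> 'm::finite) \<Rightarrow> real^('t \<times> 'p::finite) \<Rightarrow> real^('t \<times> 'n::finite)" where
  "perf_output A Bu Bw S u w = (\<chi> k. (S (fst k) *v state A Bu Bw u w (fst k)) $ snd k)"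

text \<open>
  The matrices of \<open>F\<close> and \<open>G\<close>: the output is linear in \<open>(u, w)\<close>, so they are obtained by
  switching off one of the two inputs (see \<open>perf_output_eq\<close> below).
\<close>

definition control_op ::
    "('t::{finite,linorder} \<Rightarrow> real^'n^'n) \<Rightarrow> ('t \<Rightarrow> real^'m^'n) \<Rightarrow> ('t \<Rightarrow> real^'p^'n)
     \<Rightarrow> ('t \<Rightarrow> real^'n^'n) \<Rightarrow> real^('t \<times> 'm::finite)^('t \<times> 'n::finite)" where
  "control_op A Bu Bw S =
     matrix (\<lambda>u. perf_output A Bu Bw S u (0 :: real^('t \<times> 'p::finite)))"

definition disturbance_op ::
    "('t::{finite,linorder} \<Rightarrow> real^'n^'n) \<Rightarrow> ('t \<Rightarrow> real^'m^'n) \<Rightarrow> ('t \<Rightarrow> real^'p^'n)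
     \<Rightarrow> ('t \<Rightarrow> real^'n^'n) \<Rightarrow> real^('t \<times> 'p::finite)^('t \<times> 'n::finite)" where
  "disturbance_op A Bu Bw S =
     matrix (\<lambda>w. perf_output A Bu Bw S (0 :: real^('t \<times> 'm::finite)) w)"

definition lq_cost ::
    "('t::{finite,linorder} \<Rightarrow> real^'n^'n) \<Rightarrow> ('t \<Rightarrow> real^'m^'n) \<Rightarrow> ('t \<Rightarrow> real^'p^'n)
     \<Rightarrow> ('t \<Rightarrow> real^'n^'n)
     \<Rightarrow> real^('t \<times> 'p::finite) \<Rightarrow> real^('t \<times> 'm::finite) \<Rightarrow> real" where
  "lq_cost A Bu Bw Q w u =
     (\<Sum>t\<in>UNIV. state A Bu Bw u w t \<bullet> (Q t *v state A Bu Bw u w t) + block u t \<bullet> block u t)"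

definition op_cost ::
    "real^('t::finite \<times> 'm::finite)^('t \<times> 'n::finite) \<Rightarrow> real^('t \<times> 'p::finite)^('t \<times> 'n)
     \<Rightarrow> real^('t \<times> 'p) \<Rightarrow> real^('t \<times> 'm) \<Rightarrow> real" where
  "op_cost F G w u = (norm (F *v u + G *v w))\<^sup>2 + (norm u)\<^sup>2"

text \<open>
  The two problems, for a system whose cost under disturbance \<open>w\<close> and control \<open>u\<close> is \<open>c w u\<close>.
  The infimum over all control sequences is a minimum, see \<open>op_cost_attains_min\<close>.  The
  supremum is taken in the extended reals.
\<close>

definition regret_suboptimal ::
    "(real^('t \<times> 'p) \<Rightarrow> real^('t \<times> 'm) \<Rightarrow> real) \<Rightarrow> real
     \<Rightarrow> real^('t::{finite,linorder} \<times> 'p::finite)^('t \<times> 'm::finite) \<Rightarrow> bool" where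
  "regret_suboptimal c \<gamma> K \<longleftrightarrow>
     causal K \<and>
     (\<forall>w. w \<noteq> 0 \<longrightarrow> (c w (K *v w) - (INF u'. c w u')) / (norm w)\<^sup>2 < \<gamma>\<^sup>2)"

definition hinf_suboptimal ::
    "(real^('t \<times> 'p) \<Rightarrow> real^('t \<times> 'm) \<Rightarrow> real) \<Rightarrow> real
     \<Rightarrow> real^('t::{finite,linorder} \<times> 'p::finite)^('t \<times> 'm::finite) \<Rightarrow> bool" where
  "hinf_suboptimal c \<gamma> K \<longleftrightarrow>
     causal K \<and>
     (SUP w\<in>{w. w \<noteq> 0}. ereal (c w (K *v w) / (norm w)\<^sup>2)) < ereal (\<gamma>\<^sup>2)"

text \<open>
  Causality, being block triangularity, determines the factor only up to an orthogonal
  block-diagonal matrix on the left (for instance a sign).  Given a factor \<open>\<Delta>\<close> and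
  \<open>z = \<Delta> w\<close>, the policy \<open>u = K w\<close>, expressed in terms of the disturbance \<open>z\<close>, is the operator
  \<open>K \<Delta>\<^sup>-\<^sup>1\<close>.
\<close>

definition causal_factor ::
    "real \<Rightarrow> real^('t::{finite,linorder} \<times> 'm::finite)^('t \<times> 'n::finite)
     \<Rightarrow> real^('t \<times> 'p::finite)^('t \<times> 'n) \<Rightarrow> real^('t \<times> 'p)^('t \<times> 'p) \<Rightarrow> bool" where
  "causal_factor \<gamma> F G \<Delta> \<longleftrightarrow>
     causal \<Delta> \<and>
     \<gamma>\<^sup>2 *\<^sub>R mat 1 + transpose G ** matrix_inv (mat 1 + F ** transpose F) ** G
       = transpose \<Delta> ** \<Delta>"


lemma time_induct [case_names less]:
  fixes t :: "'t::{finite,linorder}"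
  assumes "\<And>t. (\<And>r. r < t \<Longrightarrow> P r) \<Longrightarrow> P t"
  shows "P t"
proof (induction t rule: measure_induct_rule[where f = "\<lambda>t. card {..<t}"])
  case (less t)
  show ?case
  proof (rule assms)
    fix r assume "r < t"
    then have "{..<r} \<subset> {..<t}" by auto
    then show "P r" by (intro less) (simp add: psubset_card_mono)
  qed
qed

lemma Max_lessThan_less:
  fixes t :: "'t::{finite,linorder}"
  assumes "{..<t} \<noteq> {}"
  shows "Max {..<t} < t"
  using Max_in[of "{..<t}"] assms by simp

lemma block_add: "block (u + v) t = block u t + block v t"
  by (simp add: block_def vec_eq_iff)

lemma block_scale: "block (c *\<^sub>R u) t = c *\<^sub>R block u t"
  by (simp add: block_def vec_eq_iff)

lemma state_add:
  "state A Bu Bw (u + u') (w + w') t = state A Bu Bw u w t + state A Bu Bw u' w' t"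
proof (induction t rule: time_induct)
  case (less t)
  show ?case
  proof (cases "{..<t} = {}")
    case True
    then show ?thesis by (simp add: state.simps[of _ _ _ _ _ t])
  next
    case False
    show ?thesis
      using less[OF Max_lessThan_less[OF False]] False
      by (simp add: state.simps[of _ _ _ _ _ t] Let_def block_add matrix_vector_right_distrib)
  qed
qed

lemma state_scale:
  "state A Bu Bw (c *\<^sub>R u) (c *\<^sub>R w) t = c *\<^sub>R state A Bu Bw u w t"
proof (induction t rule: time_induct)
  case (less t)
  show ?case
  proof (cases "{..<t} = {}")
    case True
    then show ?thesis by (simp add: state.simps[of _ _ _ _ _ t])
  next
    case False
    show ?thesis
      using less[OF Max_lessThan_less[OF False]] False
      by (simp add: state.simps[of _ _ _ _ _ t] Let_def block_scale matrix_vector_mult_scaleR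
          scaleR_add_right)
  qed
qed

lemma state_causal:
  assumes "\<And>r. r < t \<Longrightarrow> block u r = block u' r" "\<And>r. r < t \<Longrightarrow> block w r = block w' r"
  shows "state A Bu Bw u w t = state A Bu Bw u' w' t"
  using assms
proof (induction t rule: time_induct)
  case (less t)
  show ?case
  proof (cases "{..<t} = {}")
    case True
    then show ?thesis by (simp add: state.simps[of _ _ _ _ _ t])
  next
    case False
    note lt = Max_lessThan_less[OF False]
    have "state A Bu Bw u w (Max {..<t}) = state A Bu Bw u' w' (Max {..<t})"
      using lt less.prems by (intro less.IH) auto
    then show ?thesis
      using less.prems[OF lt] False by (simp add: state.simps[of _ _ _ _ _ t] Let_def)
  qed
qed

lemma perf_output_add:
  "perf_output A Bu Bw S (u + u') (w + w')
     = perf_output A Bu Bw S u w + perf_output A Bu Bw S u' w'"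
  by (simp add: perf_output_def vec_eq_iff state_add matrix_vector_right_distrib)

lemma perf_output_scale:
  "perf_output A Bu Bw S (c *\<^sub>R u) (c *\<^sub>R w) = c *\<^sub>R perf_output A Bu Bw S u w"
  by (simp add: perf_output_def vec_eq_iff state_scale matrix_vector_mult_scaleR)

lemma linear_perf_output:
  "linear (\<lambda>u. perf_output A Bu Bw S u 0)" "linear (\<lambda>w. perf_output A Bu Bw S 0 w)"
  using perf_output_add[of A Bu Bw S _ _ 0 0] perf_output_add[of A Bu Bw S 0 0]
    perf_output_scale[of A Bu Bw S _ _ 0] perf_output_scale[of A Bu Bw S _ 0]
  by (auto intro!: linearI)

lemma control_op_apply: "control_op A Bu Bw S *v u = perf_output A Bu Bw S u 0"
  unfolding control_op_def by (rule matrix_works) (use linear_perf_output in \<open>simp add: linear_matrix_vector_mul_eq\<close>)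

lemma disturbance_op_apply: "disturbance_op A Bu Bw S *v w = perf_output A Bu Bw S 0 w"
  unfolding disturbance_op_def by (rule matrix_works) (use linear_perf_output in \<open>simp add: linear_matrix_vector_mul_eq\<close>)

lemma perf_output_eq:
  "perf_output A Bu Bw S u w = control_op A Bu Bw S *v u + disturbance_op A Bu Bw S *v w"
  using perf_output_add[of A Bu Bw S u 0 0 w]
  by (simp add: control_op_apply disturbance_op_apply)

lemma state_zero: "state A Bu Bw 0 0 t = 0"
  using state_scale[of A Bu Bw 0 0 0 t] by simp

lemma strictly_causal_control_op: "strictly_causal (control_op A Bu Bw S)"
  unfolding strictly_causal_def
proof (intro allI impI)
  fix t s i j assume "(t :: 'a) \<le> s"
  then have "state A Bu Bw (axis (s, j) 1) 0 t = state A Bu Bw 0 0 t"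
    by (intro state_causal) (auto simp: block_def axis_def vec_eq_iff)
  then show "control_op A Bu Bw S $ (t, i) $ (s, j) = 0"
    by (simp add: control_op_def matrix_def perf_output_def state_zero)
qed

lemma strictly_causal_disturbance_op: "strictly_causal (disturbance_op A Bu Bw S)"
  unfolding strictly_causal_def
proof (intro allI impI)
  fix t s i j assume "(t :: 'a) \<le> s"
  then have "state A Bu Bw 0 (axis (s, j) 1) t = state A Bu Bw 0 0 t"
    by (intro state_causal) (auto simp: block_def axis_def vec_eq_iff)
  then show "disturbance_op A Bu Bw S $ (t, i) $ (s, j) = 0"
    by (simp add: disturbance_op_def matrix_def perf_output_def state_zero)
qed

lemma norm_sq_blocks: "(norm u)\<^sup>2 = (\<Sum>t\<in>UNIV. block u t \<bullet> block u t)"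
  by (simp add: power2_norm_eq_inner inner_vec_def block_def sum.cartesian_product
      flip: UNIV_Times_UNIV)

lemma lq_cost_eq_op_cost:
  assumes "\<And>t. psd (S t)" "\<And>t. S t ** S t = Q t"
  shows "lq_cost A Bu Bw Q w u
           = op_cost (control_op A Bu Bw S) (disturbance_op A Bu Bw S) w u"
proof -
  have "x \<bullet> (Q t *v x) = (S t *v x) \<bullet> (S t *v x)" for x t
  proof -
    have "transpose (S t) = S t"
      using assms(1) by (simp add: psd_def)
    then show ?thesis
      by (simp add: dot_lmul_matrix[symmetric] assms(2)[symmetric] flip: matrix_vector_mul_assoc)
         (metis dot_lmul_matrix transpose_matrix_vector)
  qed
  moreover have "block (perf_output A Bu Bw S u w) t = S t *v state A Bu Bw u w t" for t
    by (simp add: block_def perf_output_def vec_eq_iff)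
  ultimately show ?thesis
    by (simp add: lq_cost_def op_cost_def norm_sq_blocks sum.distrib flip: perf_output_eq)
qed

lemma op_cost_attains_min: "\<exists>u0. \<forall>u. op_cost F G w u0 \<le> op_cost F G w u"
proof -
  let ?r = "sqrt (op_cost F G w 0)"
  have nn: "0 \<le> op_cost F G w u" for u
    by (simp add: op_cost_def)
  have "continuous_on (cball 0 ?r) (op_cost F G w)"
    unfolding op_cost_def by (intro continuous_intros)
  then obtain u0 where u0: "u0 \<in> cball 0 ?r" "\<forall>u\<in>cball 0 ?r. op_cost F G w u0 \<le> op_cost F G w u"
    using continuous_attains_inf[of "cball 0 ?r" "op_cost F G w"] nn[of 0] by fastforce
  have "op_cost F G w u0 \<le> op_cost F G w u" for u
  proof (cases "norm u \<le> ?r")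
    case True
    then show ?thesis using u0(2) by simp
  next
    case False
    then have "op_cost F G w 0 \<le> (norm u)\<^sup>2"
      using nn[of 0] by (metis linear norm_ge_zero not_le real_sqrt_abs abs_norm_cancel real_sqrt_le_iff)
    also have "\<dots> \<le> op_cost F G w u"
      by (simp add: op_cost_def)
    finally show ?thesis
      using u0(2) nn[of 0] by (meson centre_in_cball order_trans real_sqrt_ge_zero)
  qed
  then show ?thesis by blast
qed

end

theory Submission
  imports Defs
begin

text \<open>
  Completing the square gives \<open>cost(w,u) = g\<^sup>T y + |s - y|\<^sup>2 + |u + F\<^sup>T y|\<^sup>2\<close> with \<open>g = G w\<close> and
  \<open>y = (I + F F\<^sup>T)\<^sup>-\<^sup>1 g\<close>, so the minimal cost is the quadratic form of \<open>G\<^sup>T (I + F F\<^sup>T)\<^sup>-\<^sup>1 G\<close>.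
  Hence \<open>\<gamma>\<^sup>2 |w|\<^sup>2\<close> plus the minimal cost equals \<open>|\<Delta> w|\<^sup>2\<close>, and the regret bound for \<open>w\<close> is the bound
  \<open>cost < |z|\<^sup>2\<close> for \<open>z = \<Delta> w\<close>. By compactness of the unit sphere, the pointwise
  strict inequalities are the same as a strict bound on the supremum. The factor itself is a
  Cholesky factor, and it is unique up to \<open>U = \<Delta>' \<Delta>\<^sup>-\<^sup>1\<close>, which is orthogonal and causal with
  causal inverse \<open>U\<^sup>T\<close>, hence block diagonal.
\<close>

section \<open>Positive semidefinite matrices and inverses\<close>

lemma inner_transpose_mult: "(transpose B *v x) \<bullet> y = x \<bullet> (B *v y)"
  for B :: "real^'a^'b"
  by (simp add: transpose_matrix_vector dot_lmul_matrix)

lemma psd_plus: "psd B \<Longrightarrow> psd C \<Longrightarrow> psd (B + C)"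
  by (simp add: psd_def transpose_def vec_eq_iff matrix_vector_mult_add_rdistrib inner_add_right)

lemma psd_scaled_mat:
  assumes "0 \<le> c"
  shows "psd (c *\<^sub>R mat 1)"
proof -
  have "transpose (c *\<^sub>R mat 1) = (c *\<^sub>R mat 1 :: real^'a^'a)"
    by (simp add: transpose_def mat_def vec_eq_iff)
  then show ?thesis
    using assms by (simp add: psd_def flip: scaleR_matrix_vector_assoc)
qed

lemma psd_congruence:
  fixes W :: "real^'b^'b" and G :: "real^'a^'b"
  assumes "psd W"
  shows "psd (transpose G ** W ** G)"
proof -
  have "x \<bullet> ((transpose G ** W ** G) *v x) = (G *v x) \<bullet> (W *v (G *v x))" for x
    by (metis inner_transpose_mult matrix_vector_mul_assoc transpose_transpose)
  then show ?thesis
    using assms by (simp add: psd_def matrix_transpose_mul matrix_mul_assoc)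
qed

lemma inner_one_plus_mult_transpose:
  fixes F :: "real^'m^'n"
  shows "y \<bullet> ((mat 1 + F ** transpose F) *v y) = y \<bullet> y + (transpose F *v y) \<bullet> (transpose F *v y)"
  by (simp add: matrix_vector_mult_add_rdistrib inner_add_right
      transpose_matrix_vector dot_lmul_matrix
      flip: matrix_vector_mul_assoc)

text \<open>A kernel vector \<open>y\<close> makes \<open>y \<bullet> y\<close> plus a nonnegative
  term vanish, so \<open>y = 0\<close>; a square matrix with trivial kernel is invertible.\<close>

lemma invertible_one_plus_mult_transpose:
  fixes F :: "real^'m^'n"
  shows "invertible (mat 1 + F ** transpose F)"
proof -
  have "y = 0" if "(mat 1 + F ** transpose F) *v y = 0" for y
    using inner_one_plus_mult_transpose[of y F] that
    by (metis add_nonneg_eq_0_iff inner_eq_zero_iff inner_ge_zero inner_zero_right)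
  then show ?thesis
    using matrix_left_invertible_ker[of "mat 1 + F ** transpose F"]
    by (auto simp: invertible_left_inverse)
qed

lemma matrix_inv_mult:
  assumes "invertible B"
  shows "B ** matrix_inv B = mat 1" "matrix_inv B ** B = mat 1"
  using someI_ex[OF assms[unfolded invertible_def]] by (simp_all add: matrix_inv_def)

lemma matrix_inv_mult_vector:
  fixes B :: "real^'a^'a"
  assumes "invertible B"
  shows "B *v (matrix_inv B *v x) = x" "matrix_inv B *v (B *v x) = x"
  using assms by (simp_all add: matrix_vector_mul_assoc matrix_inv_mult)

text \<open>Symmetry of \<open>B\<close> makes the transposed inverse an inverse of \<open>B\<close>
  as well, so the two agree. The form of the inverse at \<open>x\<close> is the form of
  \<open>B\<close> at \<open>matrix_inv B *v x\<close>.\<close>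

lemma psd_inverse:
  fixes B :: "real^'a^'a"
  assumes "psd B" "invertible B"
  shows "psd (matrix_inv B)"
proof -
  let ?C = "matrix_inv B"
  have "transpose ?C ** B = mat 1"
    by (metis assms matrix_inv_mult(1) matrix_transpose_mul psd_def transpose_mat)
  then have "transpose ?C = ?C"
    using assms(2) by (metis matrix_inv_mult(1) matrix_mul_assoc matrix_mul_lid matrix_mul_rid)
  moreover have "0 \<le> x \<bullet> (?C *v x)" for x
  proof -
    have "0 \<le> (?C *v x) \<bullet> (B *v (?C *v x))"
      using assms(1) by (simp add: psd_def)
    then show ?thesis
      using assms(2) by (simp add: matrix_inv_mult_vector inner_commute)
  qed
  ultimately show ?thesis
    by (simp add: psd_def)
qed

section \<open>Minimal cost by completing the square\<close>

lemma op_cost_completed_square: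
  fixes F :: "real^('t::finite \<times> 'm::finite)^('t \<times> 'n::finite)"
    and G :: "real^('t \<times> 'p::finite)^('t \<times> 'n)"
  defines "y w \<equiv> matrix_inv (mat 1 + F ** transpose F) *v (G *v w)"
  shows "op_cost F G w u = (G *v w) \<bullet> y w
    + (norm (F *v u + G *v w - y w))\<^sup>2 + (norm (u + transpose F *v y w))\<^sup>2"
proof -
  have g: "G *v w = (mat 1 + F ** transpose F) *v y w"
    by (simp add: y_def matrix_inv_mult_vector invertible_one_plus_mult_transpose)
  have yg: "y w \<bullet> (G *v w) = y w \<bullet> y w + (transpose F *v y w) \<bullet> (transpose F *v y w)"
    unfolding g by (rule inner_one_plus_mult_transpose)
  \<comment> \<open>By this adjointness the mixed terms in \<open>u\<close> and \<open>y w\<close>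
    of the two squares cancel.\<close>
  have "y w \<bullet> (F *v u) = u \<bullet> (transpose F *v y w)"
    by (metis inner_commute inner_transpose_mult)
  with yg show ?thesis
    unfolding op_cost_def power2_norm_eq_inner
    by (simp add: inner_add_left inner_add_right inner_diff_left inner_diff_right inner_commute)
qed

text \<open>Both squares vanish at once for the control
  \<open>- (transpose F *v ?y)\<close>.\<close>

lemma Inf_op_cost:
  fixes F :: "real^('t::finite \<times> 'm::finite)^('t \<times> 'n::finite)"
    and G :: "real^('t \<times> 'p::finite)^('t \<times> 'n)"
  shows "(INF u. op_cost F G w u)
    = (G *v w) \<bullet> (matrix_inv (mat 1 + F ** transpose F) *v (G *v w))"
proof (rule cInf_eq_minimum)
  let ?y = "matrix_inv (mat 1 + F ** transpose F) *v (G *v w)"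
  have "(mat 1 + F ** transpose F) *v ?y = G *v w"
    by (simp add: matrix_inv_mult_vector invertible_one_plus_mult_transpose)
  then have "F *v (- (transpose F *v ?y)) + G *v w = ?y"
    by (simp add: matrix_vector_mult_add_rdistrib linear_neg algebra_simps
        flip: matrix_vector_mul_assoc)
  then have "op_cost F G w (- (transpose F *v ?y)) = (G *v w) \<bullet> ?y"
    by (simp add: op_cost_completed_square)
  then show "(G *v w) \<bullet> ?y \<in> range (op_cost F G w)"
    by (metis rangeI)
qed (auto simp: op_cost_completed_square)

section \<open>The norm induced by a factor\<close>

lemma norm_causal_factor:
  assumes "causal_factor \<gamma> F G \<Delta>"
  shows "(norm (\<Delta> *v w))\<^sup>2 = \<gamma>\<^sup>2 * (norm w)\<^sup>2 + (INF u. op_cost F G w u)"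
proof -
  have "(norm (\<Delta> *v w))\<^sup>2 = w \<bullet> ((transpose \<Delta> ** \<Delta>) *v w)"
    by (metis inner_transpose_mult matrix_vector_mul_assoc power2_norm_eq_inner transpose_transpose)
  also have "transpose \<Delta> ** \<Delta>
      = \<gamma>\<^sup>2 *\<^sub>R mat 1 + transpose G ** matrix_inv (mat 1 + F ** transpose F) ** G"
    using assms by (simp add: causal_factor_def)
  also have "w \<bullet> (\<dots> *v w) = \<gamma>\<^sup>2 * (norm w)\<^sup>2
      + w \<bullet> (transpose G *v (matrix_inv (mat 1 + F ** transpose F) *v (G *v w)))"
    by (simp add: matrix_vector_mult_add_rdistrib inner_add_right power2_norm_eq_inner
        flip: matrix_vector_mul_assoc scaleR_matrix_vector_assoc)
  finally show ?thesis
    unfolding Inf_op_cost by (metis inner_transpose_mult transpose_transpose)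
qed

text \<open>The minimal cost is nonnegative, so the norm of \<open>\<Delta> *v w\<close> is at least
  \<open>\<gamma> * norm w\<close>, which excludes a kernel.\<close>

lemma invertible_causal_factor:
  assumes "causal_factor \<gamma> F G \<Delta>" "\<gamma> > 0"
  shows "invertible \<Delta>"
proof -
  have "w = 0" if "\<Delta> *v w = 0" for w
  proof -
    have "0 \<le> (INF u. op_cost F G w u)"
      by (rule cINF_greatest) (auto simp: op_cost_def)
    moreover have "\<gamma>\<^sup>2 * (norm w)\<^sup>2 + (INF u. op_cost F G w u) = 0"
      using norm_causal_factor[OF assms(1), of w] that by simp
    ultimately have "\<gamma>\<^sup>2 * (norm w)\<^sup>2 = 0"
      by (smt (verit) zero_le_mult_iff zero_le_power2)
    then show ?thesis
      using assms(2) by simp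
  qed
  then show ?thesis
    using matrix_left_invertible_ker[of \<Delta>] by (auto simp: invertible_left_inverse)
qed

section \<open>Existence of a causal factor\<close>

text \<open>Cholesky elimination, starting from the index of largest rank \<open>r\<close>; ties in \<open>r\<close> are allowed,
  which makes the triangularity of the factor a block triangularity.\<close>

lemma psd_triangular_factor_on:
  fixes r :: "'i::finite \<Rightarrow> 'l::linorder" and M :: "real^'i^'i"
  assumes "psd M" "\<And>i j. i \<notin> J \<Longrightarrow> M $ i $ j = 0"
  shows "\<exists>L. (\<forall>i j. r i < r j \<longrightarrow> L $ i $ j = 0) \<and> (\<forall>i j. i \<notin> J \<longrightarrow> L $ i $ j = 0)
    \<and> transpose L ** L = M"
  using finite[of J] assms
proof (induction "card J" arbitrary: J M)
  case 0
  then have "M = 0"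
    by (simp add: vec_eq_iff)
  then show ?case
    by (intro exI[of _ 0]) (simp add: transpose_def vec_eq_iff matrix_matrix_mult_def)
next
  case (Suc k)
  have "transpose M = M"
    using Suc.prems(2) by (simp add: psd_def)
  then have sym: "M $ i $ j = M $ j $ i" for i j
    by (simp add: transpose_def vec_eq_iff)
  have nn: "0 \<le> x \<bullet> (M *v x)" for x
    using Suc.prems(2) by (simp add: psd_def)
  have "J \<noteq> {}"
    using Suc.hyps by auto
  then have "Max (r ` J) \<in> r ` J"
    by simp
  then obtain a where "a \<in> J" "r a = Max (r ` J)"
    by (metis imageE)
  then have a: "a \<in> J" "\<And>j. j \<in> J \<Longrightarrow> r j \<le> r a"
    by simp_all
  define m where "m = M $ a"
  have Ma: "M *v axis a 1 = m"
    by (simp add: matrix_vector_mul_component vec_eq_iff inner_axis m_def sym)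
  \<comment> \<open>How the form depends on the pivot coordinate: this yields both the zero pivot
    case and the semidefiniteness of \<open>M'\<close>.\<close>
  have quad: "(x + c *\<^sub>R axis a 1) \<bullet> (M *v (x + c *\<^sub>R axis a 1))
      = x \<bullet> (M *v x) + 2 * c * (m \<bullet> x) + c\<^sup>2 * m $ a" for x c
  proof -
    have "axis a 1 \<bullet> (M *v x) = m \<bullet> x"
      by (simp add: inner_axis' matrix_vector_mul_component m_def)
    then show ?thesis
      by (simp add: matrix_vector_right_distrib matrix_vector_mult_scaleR Ma inner_add_left
          inner_add_right inner_axis inner_axis' inner_commute power2_eq_square algebra_simps)
  qed
  have m0: "0 \<le> m $ a"
    using nn[of "axis a 1"] by (simp add: Ma inner_axis')
  \<comment> \<open>For a zero pivot, division by zero gives \<open>v = 0\<close>; this is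
    consistent because \<open>row\<close> shows that the pivot row then vanishes.\<close>
  define v where "v = (1 / sqrt (m $ a)) *\<^sub>R m"
  \<comment> \<open>The Schur complement of the pivot.\<close>
  define M' where "M' = M - (\<chi> i j. v $ i * v $ j)"
  have M'v: "M' *v x = M *v x - (v \<bullet> x) *\<^sub>R v" for x
    by (simp add: M'_def vec_eq_iff matrix_vector_mult_def inner_vec_def sum_subtractf
        left_diff_distrib right_diff_distrib sum_distrib_left mult_ac)
  \<comment> \<open>With a zero pivot the form is affine in \<open>c\<close>, so its nonnegativity
    forces the slope to vanish.\<close>
  have row: "m = 0" if "m $ a = 0"
  proof -
    have lin: "0 \<le> M $ j $ j + 2 * c * m $ j" for j c
    proof -
      have "axis j 1 \<bullet> (M *v axis j 1) = M $ j $ j" "m \<bullet> axis j 1 = m $ j"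
        by (simp_all add: inner_axis inner_axis' matrix_vector_mul_component)
      then show ?thesis
        using quad[of "axis j 1" c] nn[of "axis j 1 + c *\<^sub>R axis a 1"] that by simp
    qed
    have "m $ j = 0" for j
    proof (rule ccontr)
      assume "m $ j \<noteq> 0"
      then show False
        \<comment> \<open>This \<open>c\<close> turns the bound into
          \<open>0 \<le> -1\<close>.\<close>
        using lin[of j "- (M $ j $ j + 1) / (2 * m $ j)"] by (simp add: field_simps)
    qed
    then show ?thesis
      by (simp add: vec_eq_iff)
  qed
  have vv: "v $ i * v $ j = m $ i * m $ j / m $ a" for i j
    using m0 by (simp add: v_def)
  have "0 \<le> x \<bullet> (M' *v x)" for x
  proof (cases "m $ a = 0")
    case True
    then show ?thesis
      using nn[of x] by (simp add: M'v v_def)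
  next
    case False
    \<comment> \<open>The minimiser of the form of \<open>M\<close> along
      \<open>x + c *\<^sub>R axis a 1\<close>; the minimum is the form of \<open>M'\<close> at
      \<open>x\<close>.\<close>
    let ?c = "- (m \<bullet> x) / m $ a"
    have "(v \<bullet> x)\<^sup>2 = (m \<bullet> x)\<^sup>2 / m $ a"
      using m0 by (simp add: v_def power_divide)
    moreover have "2 * ?c * (m \<bullet> x) + ?c\<^sup>2 * m $ a = - ((m \<bullet> x)\<^sup>2 / m $ a)"
      using False by (simp add: field_simps power2_eq_square)
    ultimately have "x \<bullet> (M' *v x) = (x + ?c *\<^sub>R axis a 1) \<bullet> (M *v (x + ?c *\<^sub>R axis a 1))"
      unfolding quad by (simp add: M'v inner_diff_right inner_commute power2_eq_square)
    then show ?thesis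
      using nn by metis
  qed
  moreover have "transpose M' = M'"
    by (simp add: M'_def transpose_def vec_eq_iff sym mult.commute)
  ultimately have "psd M'"
    by (simp add: psd_def)
  moreover have "M' $ i $ j = 0" if "i \<notin> J - {a}" for i j
  proof (cases "i = a")
    case True
    then show ?thesis
      using row by (cases "m $ a = 0") (auto simp: M'_def vv simp flip: m_def)
  next
    case False
    then have "M $ i $ j = 0" "m $ i = 0"
      using Suc.prems(3)[of i] sym[of a i] that by (auto simp: m_def)
    then show ?thesis
      by (simp add: M'_def vv)
  qed
  moreover have "k = card (J - {a})"
    using Suc.hyps(2) a(1) by simp
  ultimately obtain L where L: "\<And>i j. r i < r j \<Longrightarrow> L $ i $ j = 0"
      "\<And>i j. i \<notin> J - {a} \<Longrightarrow> L $ i $ j = 0" "transpose L ** L = M'"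
    using Suc.hyps(1)[of "J - {a}" M', OF _ finite] by blast
  \<comment> \<open>Row \<open>a\<close> of \<open>L\<close> is zero since \<open>a\<close> is not
    in \<open>J - {a}\<close>, so filling it with \<open>v\<close> adds exactly the rank-one matrix
    that was subtracted.\<close>
  define N where "N = (\<chi> i. if i = a then v else L $ i)"
  \<comment> \<open>Maximality of \<open>r a\<close> puts every index of larger rank outside
    \<open>J\<close>, so the new row keeps the triangular shape.\<close>
  have "v $ j = 0" if "r a < r j" for j
  proof -
    have "j \<notin> J"
      using a(2) that by force
    then show ?thesis
      using Suc.prems(3)[of j a] sym[of a j] by (simp add: v_def m_def)
  qed
  then have "\<forall>i j. r i < r j \<longrightarrow> N $ i $ j = 0"
    using L(1) by (auto simp: N_def)
  moreover have "\<forall>i j. i \<notin> J \<longrightarrow> N $ i $ j = 0"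
    using L(2) a(1) by (auto simp: N_def)
  moreover have "transpose N ** N = M"
  proof -
    have "(transpose N ** N) $ i $ j = M $ i $ j" for i j
    proof -
      have "(transpose N ** N) $ i $ j = (\<Sum>k\<in>UNIV. N $ k $ i * N $ k $ j)"
        by (simp add: matrix_matrix_mult_def transpose_def)
      also have "\<dots> = (\<Sum>k\<in>UNIV. L $ k $ i * L $ k $ j + (if k = a then v $ i * v $ j else 0))"
        using L(2)[of a] by (intro sum.cong) (auto simp: N_def)
      also have "\<dots> = (transpose L ** L) $ i $ j + v $ i * v $ j"
        by (simp add: sum.distrib matrix_matrix_mult_def transpose_def)
      finally show ?thesis
        by (simp add: L(3) M'_def)
    qed
    then show ?thesis
      by (simp add: vec_eq_iff)
  qed
  ultimately show ?case
    by blast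
qed

text \<open>Ranking index pairs by time alone turns triangularity with ties into causality.\<close>

lemma psd_causal_factor:
  fixes M :: "real^('t::{finite,linorder} \<times> 'p::finite)^('t \<times> 'p)"
  assumes "psd M"
  shows "\<exists>\<Delta> :: real^('t \<times> 'p)^('t \<times> 'p). causal \<Delta> \<and> transpose \<Delta> ** \<Delta> = M"
proof -
  obtain \<Delta> :: "real^('t \<times> 'p)^('t \<times> 'p)"
    where "\<forall>i j. fst i < fst j \<longrightarrow> \<Delta> $ i $ j = 0" "transpose \<Delta> ** \<Delta> = M"
    using psd_triangular_factor_on[of M UNIV fst] assms by (metis UNIV_I)
  moreover from this have "causal \<Delta>"
    by (simp add: causal_def)
  ultimately show ?thesis
    by blast
qed

lemma causal_factor_exists: "\<exists>\<Delta>. causal_factor \<gamma> F G \<Delta>"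
proof -
  \<comment> \<open>\<open>F ** transpose F\<close> is the congruence of the identity by
    \<open>transpose F\<close>.\<close>
  have "psd (mat 1 + F ** transpose F)"
    using psd_plus[OF psd_scaled_mat[of 1] psd_congruence[OF psd_scaled_mat[of 1], of "transpose F"]]
    by simp
  then have "psd (matrix_inv (mat 1 + F ** transpose F))"
    by (intro psd_inverse invertible_one_plus_mult_transpose)
  then have "psd (\<gamma>\<^sup>2 *\<^sub>R mat 1 + transpose G ** matrix_inv (mat 1 + F ** transpose F) ** G)"
    by (intro psd_plus psd_scaled_mat psd_congruence) simp_all
  from psd_causal_factor[OF this] show ?thesis
    by (metis causal_factor_def)
qed

section \<open>Causal inverses and uniqueness of the factor\<close>

text \<open>These subspaces make inverses of causal operators causal: an invertible map of a
  finite-dimensional subspace into itself is onto it.\<close>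

definition zero_before :: "'t::{finite,linorder} \<Rightarrow> (real^('t \<times> 'p::finite)) set" where
  "zero_before s = {x. \<forall>k. fst k < s \<longrightarrow> x $ k = 0}"

text \<open>Column \<open>(s, j)\<close> of \<open>K\<close> is the image of an axis vector in
  \<open>zero_before s\<close>. Invariance of subspaces passes to products without any index
  computation.\<close>

lemma causal_iff_zero_before:
  "causal K \<longleftrightarrow> (\<forall>s. \<forall>x\<in>zero_before s. K *v x \<in> zero_before s)"
proof
  assume "causal K"
  then show "\<forall>s. \<forall>x\<in>zero_before s. K *v x \<in> zero_before s"
    by (auto simp: causal_def zero_before_def matrix_vector_mult_def intro!: sum.neutral)
      (metis (no_types, opaque_lifting) not_le order.strict_trans2)
next
  assume *: "\<forall>s. \<forall>x\<in>zero_before s. K *v x \<in> zero_before s"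
  show "causal K"
    unfolding causal_def
  proof (intro allI impI)
    fix t s i j assume "(t :: 'a) < s"
    moreover have "K *v axis (s, j) 1 \<in> zero_before s"
      by (intro *[rule_format]) (auto simp: zero_before_def axis_def)
    ultimately show "K $ (t, i) $ (s, j) = 0"
      by (simp add: zero_before_def matrix_vector_mul_component inner_axis)
  qed
qed

lemma causal_mult: "causal K \<Longrightarrow> causal L \<Longrightarrow> causal (K ** L)"
  by (simp add: causal_iff_zero_before flip: matrix_vector_mul_assoc)

lemma causal_matrix_inv:
  fixes \<Delta> :: "real^('t::{finite,linorder} \<times> 'p::finite)^('t \<times> 'p)"
  assumes "causal \<Delta>" "invertible \<Delta>"
  shows "causal (matrix_inv \<Delta>)"
  unfolding causal_iff_zero_before
proof (intro allI ballI)
  fix s and x :: "real^('t \<times> 'p)" assume x: "x \<in> zero_before s"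
  let ?V = "zero_before s :: (real^('t \<times> 'p)) set"
  have sub: "subspace ?V"
    by (auto simp: subspace_def zero_before_def)
  have inj: "inj ((*v) \<Delta>)"
    by (rule inj_on_inverseI[where g = "(*v) (matrix_inv \<Delta>)"])
      (simp add: assms(2) matrix_inv_mult_vector)
  have "dim ((*v) \<Delta> ` ?V) = dim ?V"
    by (rule dim_image_eq) (use inj in \<open>auto intro: inj_on_subset\<close>)
  moreover have "(*v) \<Delta> ` ?V \<subseteq> ?V"
    using assms(1) by (auto simp: causal_iff_zero_before)
  ultimately have "(*v) \<Delta> ` ?V = ?V"
    by (intro subspace_dim_equal linear_subspace_image sub) auto
  then obtain y where "y \<in> ?V" "x = \<Delta> *v y"
    using x by auto
  then show "matrix_inv \<Delta> *v x \<in> zero_before s"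
    using assms(2) by (simp add: matrix_inv_mult_vector)
qed

lemma causal_factor_unique:
  assumes "causal_factor \<gamma> F G \<Delta>" "causal_factor \<gamma> F G \<Delta>'" "\<gamma> > 0"
  shows "\<exists>U. block_diagonal U \<and> orthogonal_matrix U \<and> \<Delta>' = U ** \<Delta>"
proof -
  note inv = invertible_causal_factor[OF assms(1,3)] invertible_causal_factor[OF assms(2,3)]
  have caus: "causal \<Delta>" "causal \<Delta>'" and eq: "transpose \<Delta>' ** \<Delta>' = transpose \<Delta> ** \<Delta>"
    using assms(1,2) by (simp_all add: causal_factor_def)
  define U where "U = \<Delta>' ** matrix_inv \<Delta>"
  have "transpose U ** U = transpose (matrix_inv \<Delta>) ** (transpose \<Delta>' ** \<Delta>') ** matrix_inv \<Delta>"
    by (simp add: U_def matrix_transpose_mul matrix_mul_assoc)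
  also have "\<dots> = transpose (\<Delta> ** matrix_inv \<Delta>) ** (\<Delta> ** matrix_inv \<Delta>)"
    by (simp add: eq matrix_transpose_mul matrix_mul_assoc)
  finally have orth: "orthogonal_matrix U"
    by (simp add: orthogonal_matrix inv matrix_inv_mult transpose_mat)
  have UV: "U ** (\<Delta> ** matrix_inv \<Delta>') = mat 1"
    unfolding U_def
    by (metis inv matrix_inv_mult matrix_mul_assoc matrix_mul_rid)
  \<comment> \<open>Orthogonality identifies \<open>transpose U\<close> with the right inverse of
    \<open>U\<close>, a product of causal operators.\<close>
  have "transpose U = \<Delta> ** matrix_inv \<Delta>'"
    using orth UV by (metis matrix_mul_assoc matrix_mul_lid matrix_mul_rid orthogonal_matrix)
  then have "causal U" "causal (transpose U)"
    using caus inv by (simp_all add: U_def causal_mult causal_matrix_inv)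
  \<comment> \<open>Causality clears one side of the block diagonal, causality of the transpose the
    other.\<close>
  then have "block_diagonal U"
    by (auto simp: causal_def block_diagonal_def transpose_def neq_iff)
  moreover have "\<Delta>' = U ** \<Delta>"
    by (simp add: U_def inv matrix_inv_mult flip: matrix_mul_assoc)
  ultimately show ?thesis
    using orth by blast
qed

section \<open>Regret and H-infinity bounds\<close>

lemma op_cost_scale: "op_cost F G (c *\<^sub>R w) (c *\<^sub>R u) = c\<^sup>2 * op_cost F G w u"
  by (simp add: op_cost_def matrix_vector_mult_scaleR power_mult_distrib distrib_left
      flip: scaleR_add_right)

text \<open>The ratio is invariant under scaling of \<open>w\<close>, so its supremum is attained on
  the unit sphere, and the strict bound at a maximiser bounds the supremum strictly.\<close>

lemma hinf_suboptimal_iff: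
  fixes K :: "real^('t::{finite,linorder} \<times> 'p::finite)^('t \<times> 'm::finite)"
  shows "hinf_suboptimal (op_cost F G) \<gamma> K \<longleftrightarrow>
    causal K \<and> (\<forall>w. w \<noteq> 0 \<longrightarrow> op_cost F G w (K *v w) < \<gamma>\<^sup>2 * (norm w)\<^sup>2)"
proof -
  define c where "c w = op_cost F G w (K *v w)" for w
  have "(SUP w\<in>{w. w \<noteq> 0}. ereal (c w / (norm w)\<^sup>2)) < ereal (\<gamma>\<^sup>2)
      \<longleftrightarrow> (\<forall>w. w \<noteq> 0 \<longrightarrow> c w < \<gamma>\<^sup>2 * (norm w)\<^sup>2)" (is "?sup < _ \<longleftrightarrow> _")
  proof
    assume *: "?sup < ereal (\<gamma>\<^sup>2)"
    show "\<forall>w. w \<noteq> 0 \<longrightarrow> c w < \<gamma>\<^sup>2 * (norm w)\<^sup>2"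
    proof (intro allI impI)
      fix w :: "real^('t \<times> 'p)" assume w: "w \<noteq> 0"
      then have "ereal (c w / (norm w)\<^sup>2) \<le> ?sup"
        by (intro SUP_upper) simp
      with * have "ereal (c w / (norm w)\<^sup>2) < ereal (\<gamma>\<^sup>2)"
        by (rule le_less_trans[rotated])
      with w show "c w < \<gamma>\<^sup>2 * (norm w)\<^sup>2"
        by (simp add: divide_less_eq)
    qed
  next
    assume *: "\<forall>w. w \<noteq> 0 \<longrightarrow> c w < \<gamma>\<^sup>2 * (norm w)\<^sup>2"
    have "continuous_on (sphere 0 1) c"
      unfolding c_def op_cost_def matrix_vector_mul_assoc by (intro continuous_intros)
    \<comment> \<open>An arbitrary axis vector shows that the sphere is nonempty, as attaining a
      maximum requires.\<close>
    moreover have "axis undefined 1 \<in> sphere (0 :: real^('t \<times> 'p)) 1"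
      by simp
    ultimately obtain w0 where w0: "norm w0 = 1" "\<And>w. norm w = 1 \<Longrightarrow> c w \<le> c w0"
      using continuous_attains_sup[of "sphere 0 1" c] by (metis compact_sphere dist_0_norm
          empty_iff mem_sphere)
    have "c w / (norm w)\<^sup>2 \<le> c w0" if "w \<noteq> 0" for w
    proof -
      have "c ((1 / norm w) *\<^sub>R w) \<le> c w0"
        using that by (intro w0) simp
      then show ?thesis
        unfolding c_def by (simp add: matrix_vector_mult_scaleR op_cost_scale power_divide)
    qed
    then have "?sup \<le> ereal (c w0)"
      by (intro SUP_least) simp
    also have "c w0 < \<gamma>\<^sup>2"
      using *[rule_format, of w0] w0(1) by force
    finally show "?sup < ereal (\<gamma>\<^sup>2)"
      by simp
  qed
  then show ?thesis
    by (simp add: hinf_suboptimal_def c_def)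
qed

text \<open>Under \<open>z = \<Delta> *v w\<close> both systems have the same output and control,
  hence the same cost, while the norm of \<open>z\<close> absorbs the minimal cost and
  \<open>\<gamma>\<close>; this is why the new level is 1.\<close>

lemma regret_suboptimal_iff_hinf_suboptimal:
  fixes K :: "real^('t::{finite,linorder} \<times> 'p::finite)^('t \<times> 'm::finite)"
  assumes "causal_factor \<gamma> F G \<Delta>" "\<gamma> > 0" "causal K"
  shows "regret_suboptimal (op_cost F G) \<gamma> K \<longleftrightarrow>
    hinf_suboptimal (op_cost F (G ** matrix_inv \<Delta>)) 1 (K ** matrix_inv \<Delta>)"
proof -
  let ?D = "matrix_inv \<Delta>"
  have inv: "invertible \<Delta>"
    using assms(1,2) by (rule invertible_causal_factor)
  have "causal (K ** ?D)"
    using assms by (intro causal_mult causal_matrix_inv inv) (simp_all add: causal_factor_def)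
  moreover have "op_cost F (G ** ?D) (\<Delta> *v w) ((K ** ?D) *v (\<Delta> *v w)) = op_cost F G w (K *v w)"
    for w
    by (simp add: op_cost_def matrix_inv_mult_vector inv flip: matrix_vector_mul_assoc)
  \<comment> \<open>Invertibility of \<open>\<Delta>\<close> makes the nonzero \<open>z\<close>
    exactly the images of the nonzero \<open>w\<close>.\<close>
  moreover have "(\<forall>z. z \<noteq> 0 \<longrightarrow> op_cost F (G ** ?D) z ((K ** ?D) *v z) < (norm z)\<^sup>2) \<longleftrightarrow>
      (\<forall>w. w \<noteq> 0 \<longrightarrow> op_cost F (G ** ?D) (\<Delta> *v w) ((K ** ?D) *v (\<Delta> *v w)) < (norm (\<Delta> *v w))\<^sup>2)"
    using matrix_inv_mult_vector[OF inv] by (metis matrix_vector_mult_0_right)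
  ultimately have "hinf_suboptimal (op_cost F (G ** ?D)) 1 (K ** ?D) \<longleftrightarrow>
      (\<forall>w. w \<noteq> 0 \<longrightarrow> op_cost F G w (K *v w) < (norm (\<Delta> *v w))\<^sup>2)"
    by (simp add: hinf_suboptimal_iff)
  also have "\<dots> \<longleftrightarrow> regret_suboptimal (op_cost F G) \<gamma> K"
    by (auto simp: regret_suboptimal_def assms(3) norm_causal_factor[OF assms(1)] divide_less_eq
        algebra_simps)
  finally show ?thesis
    by simp
qed

theorem theorem5:
  fixes A :: "'t::{finite,linorder} \<Rightarrow> real^'n^'n"
    and Bu :: "'t \<Rightarrow> real^'m^'n"
    and Bw :: "'t \<Rightarrow> real^'p^'n"
    and Q S :: "'t \<Rightarrow> real^'n^'n"
    and F :: "real^('t \<times> 'm)^('t \<times> 'n)"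
    and G :: "real^('t \<times> 'p)^('t \<times> 'n)"
    and \<gamma> :: real
  assumes "\<And>t. psd (Q t)"
    and "\<And>t. psd (S t) \<and> S t ** S t = Q t"
    and "F = control_op A Bu Bw S"
    and "G = disturbance_op A Bu Bw S"
    and "\<gamma> > 0"
  shows "(\<exists>\<Delta>. causal_factor \<gamma> F G \<Delta>)
    \<and> (\<forall>\<Delta> \<Delta>'. causal_factor \<gamma> F G \<Delta> \<and> causal_factor \<gamma> F G \<Delta>' \<longrightarrow>
          (\<exists>U. block_diagonal U \<and> orthogonal_matrix U \<and> \<Delta>' = U ** \<Delta>))
    \<and> (\<forall>\<Delta>. causal_factor \<gamma> F G \<Delta> \<longrightarrow>
          invertible \<Delta> \<and>
          (\<forall>K :: real^('t \<times> 'p)^('t \<times> 'm). causal K \<longrightarrow>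
             (regret_suboptimal (lq_cost A Bu Bw Q) \<gamma> K \<longleftrightarrow>
              hinf_suboptimal (op_cost F (G ** matrix_inv \<Delta>)) 1 (K ** matrix_inv \<Delta>))))"
proof -
  have "lq_cost A Bu Bw Q = op_cost F G"
    by (intro ext) (simp add: assms(2-4) lq_cost_eq_op_cost[of S Q])
  then show ?thesis
    using causal_factor_exists causal_factor_unique invertible_causal_factor
      regret_suboptimal_iff_hinf_suboptimal assms(5)
    by metis
qed

end
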